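(* Let $p\ge 3$ be an integer and let $H=*2p\infty$ be the extended Hecke group, i.e. the group with presentation $$H=\langle P,Q,R : P^2=Q^2=R^2=(RP)^2=(QR)^p=e\rangle .$$ Then: (i) if $p$ is even, $H$ has exactly $7$ subgroups of index $2$; (ii) if $p$ is divisible by both $2$ and $3$, $H$ has exactly $3$ subgroups of index $3$ up to conjugacy in $H$; (iii) if $p$ is divisible by $2$, $3$ and $4$, $H$ has exactly $22$ subgroups of index $4$ up to conjugacy in $H$.
   Context: The extended Hecke group, denoted $*2p\infty$ in orbifold notation, is the group generated by the reflections $P,Q,R$ in the sides of a hyperbolic triangle with interior angles $\pi/2$, $\pi/p$ and $0$, labelled so that $RP$ is a rotation of order $2$, $QR$ is a rotation of order $p$, and $QP$ has infinite order; it has the presentation $\langle P,Q,R : P^2=Q^2=R^2=(RP)^2=(QR)^p=e\rangle$. "Up to conjugacy in $H$" means that conjugate subgroups of $H$ are counted once. *)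

theory Defs
  imports "HOL-Algebra.Group_Action"
begin

section \<open>Groups given by generators and relators\<close>

text \<open>
  The elements of the type \<open>'a\<close> are the generators. A word is a list of letters; the letter
  \<open>(True, x)\<close> stands for \<open>x\<close> and \<open>(False, x)\<close> for its formal inverse.
\<close>

type_synonym 'a gword = "(bool \<times> 'a) list"

text \<open>
  The congruence on the monoid of words generated by free cancellation and by \<open>r = 1\<close> for every
  relator \<open>r\<close>. Its quotient is the free group on \<open>'a\<close> modulo the normal closure of the relators.
\<close>

inductive pres_eq :: "'a gword set \<Rightarrow> 'a gword \<Rightarrow> 'a gword \<Rightarrow> bool" for rels where
  pres_refl: "pres_eq rels u u"
| pres_sym: "pres_eq rels u v \<Longrightarrow> pres_eq rels v u"
| pres_trans: "pres_eq rels u v \<Longrightarrow> pres_eq rels v w \<Longrightarrow> pres_eq rels u w"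
| pres_cancel: "pres_eq rels (u @ [(b, x), (\<not> b, x)] @ v) (u @ v)"
| pres_relator: "r \<in> rels \<Longrightarrow> pres_eq rels (u @ r @ v) (u @ v)"

definition pres_class :: "'a gword set \<Rightarrow> 'a gword \<Rightarrow> 'a gword set" where
  "pres_class rels u = {v. pres_eq rels u v}"

definition presented_group :: "'a gword set \<Rightarrow> 'a gword set monoid" where
  "presented_group rels =
    \<lparr>carrier = range (pres_class rels),
     mult = (\<lambda>A B. \<Union>u\<in>A. \<Union>v\<in>B. pres_class rels (u @ v)),
     one = pres_class rels []\<rparr>"

lemma pres_class_eq_iff: "pres_class rels u = pres_class rels v \<longleftrightarrow> pres_eq rels u v"
proof
  assume eq: "pres_class rels u = pres_class rels v"
  have "v \<in> pres_class rels v" by (simp add: pres_class_def pres_refl)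
  then have "v \<in> pres_class rels u" by (simp only: eq)
  then show "pres_eq rels u v" by (simp add: pres_class_def)
next
  assume uv: "pres_eq rels u v"
  have "pres_eq rels u w \<longleftrightarrow> pres_eq rels v w" for w
    using pres_trans[OF uv, of w] pres_trans[OF pres_sym[OF uv], of w] by iprover
  then show "pres_class rels u = pres_class rels v" by (simp add: pres_class_def)
qed

lemma pres_eq_append_left: "pres_eq rels u v \<Longrightarrow> pres_eq rels (w @ u) (w @ v)"
proof (induction rule: pres_eq.induct)
  case (pres_cancel u b x v)
  show ?case using pres_eq.pres_cancel[of rels "w @ u" b x v] by simp
next
  case (pres_relator r u v)
  then show ?case using pres_eq.pres_relator[of r rels "w @ u" v] by simp
qed (fact pres_refl, erule pres_sym, erule (1) pres_trans)

lemma pres_eq_append_right: "pres_eq rels u v \<Longrightarrow> pres_eq rels (u @ w) (v @ w)"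
proof (induction rule: pres_eq.induct)
  case (pres_cancel u b x v)
  show ?case using pres_eq.pres_cancel[of rels u b x "v @ w"] by simp
next
  case (pres_relator r u v)
  then show ?case using pres_eq.pres_relator[of r rels u "v @ w"] by simp
qed (fact pres_refl, erule pres_sym, erule (1) pres_trans)

lemma pres_eq_append:
  "pres_eq rels u u' \<Longrightarrow> pres_eq rels v v' \<Longrightarrow> pres_eq rels (u @ v) (u' @ v')"
  by (rule pres_trans[OF pres_eq_append_right pres_eq_append_left])

lemma mult_presented_group:
  "pres_class rels u \<otimes>\<^bsub>presented_group rels\<^esub> pres_class rels v = pres_class rels (u @ v)"
proof -
  let ?A = "pres_class rels u" and ?B = "pres_class rels v"
  have eq: "pres_class rels (u' @ v') = pres_class rels (u @ v)" if "u' \<in> ?A" "v' \<in> ?B" for u' v'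
  proof -
    have "pres_eq rels (u @ v) (u' @ v')"
      using that by (intro pres_eq_append) (simp_all add: pres_class_def)
    then show ?thesis unfolding pres_class_eq_iff by (rule pres_sym)
  qed
  have u: "u \<in> ?A" and v: "v \<in> ?B"
    by (simp_all add: pres_class_def pres_refl)
  have "(\<Union>u'\<in>?A. \<Union>v'\<in>?B. pres_class rels (u' @ v')) = (\<Union>u'\<in>?A. \<Union>v'\<in>?B. pres_class rels (u @ v))"
    by (intro SUP_cong refl eq)
  also have "\<dots> = pres_class rels (u @ v)"
    using u v by blast
  finally show ?thesis by (simp add: presented_group_def)
qed

lemma carrier_presented_group: "carrier (presented_group rels) = range (pres_class rels)"
  by (simp add: presented_group_def)

lemma one_presented_group: "\<one>\<^bsub>presented_group rels\<^esub> = pres_class rels []"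
  by (simp add: presented_group_def)

lemma pres_eq_inverse_word:
  "pres_eq rels (rev (map (\<lambda>(b, x). (\<not> b, x)) w) @ w) []"
proof (induction w)
  case Nil
  show ?case by (simp add: pres_refl)
next
  case (Cons a w)
  obtain b x where a: "a = (b, x)" by (cases a)
  show ?case
    using pres_trans[OF pres_cancel[of rels "rev (map (\<lambda>(b, x). (\<not> b, x)) w)" "\<not> b" x w] Cons.IH]
    by (simp add: a)
qed

lemma group_presented_group: "group (presented_group rels)"
proof (rule groupI)
  fix A assume "A \<in> carrier (presented_group rels)"
  then obtain w where A: "A = pres_class rels w"
    by (auto simp: carrier_presented_group)
  have "pres_class rels (rev (map (\<lambda>(b, x). (\<not> b, x)) w)) \<otimes>\<^bsub>presented_group rels\<^esub> A
      = \<one>\<^bsub>presented_group rels\<^esub>"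
    by (simp add: A mult_presented_group one_presented_group pres_class_eq_iff pres_eq_inverse_word)
  then show "\<exists>B\<in>carrier (presented_group rels).
      B \<otimes>\<^bsub>presented_group rels\<^esub> A = \<one>\<^bsub>presented_group rels\<^esub>"
    by (auto simp: carrier_presented_group)
qed (auto simp: carrier_presented_group one_presented_group mult_presented_group)

lemma relator_presented_group:
  "r \<in> rels \<Longrightarrow> pres_class rels r = \<one>\<^bsub>presented_group rels\<^esub>"
  using pres_relator[of r rels "[]" "[]"] by (simp add: one_presented_group pres_class_eq_iff)

primrec eval_gword :: "('b, 'c) monoid_scheme \<Rightarrow> ('a \<Rightarrow> 'b) \<Rightarrow> 'a gword \<Rightarrow> 'b" where
  "eval_gword G f [] = \<one>\<^bsub>G\<^esub>"
| "eval_gword G f (a # w) =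
    (if fst a then f (snd a) else inv\<^bsub>G\<^esub> f (snd a)) \<otimes>\<^bsub>G\<^esub> eval_gword G f w"

text \<open>The universal property of the presentation.\<close>

lemma presented_group_universal:
  assumes "group G" and f: "\<And>x. f x \<in> carrier G"
    and rels: "\<And>r. r \<in> rels \<Longrightarrow> eval_gword G f r = \<one>\<^bsub>G\<^esub>"
  shows "\<exists>h \<in> hom (presented_group rels) G. \<forall>w. h (pres_class rels w) = eval_gword G f w"
proof -
  interpret group G by fact
  have closed: "eval_gword G f w \<in> carrier G" for w
    by (induction w) (auto simp: f)
  have append: "eval_gword G f (u @ v) = eval_gword G f u \<otimes>\<^bsub>G\<^esub> eval_gword G f v" for u v
    by (induction u) (auto simp: f closed m_assoc)
  have pair: "eval_gword G f [(b, x), (\<not> b, x)] = \<one>\<^bsub>G\<^esub>" for b x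
    by (cases b) (auto simp: f)
  have resp: "eval_gword G f u = eval_gword G f v" if "pres_eq rels u v" for u v
    using that
  proof (induction rule: pres_eq.induct)
    case (pres_cancel u b x v)
    show ?case unfolding append pair by (simp add: closed)
  next
    case (pres_relator r u v)
    then show ?case by (simp add: append rels closed)
  qed simp_all
  define h where "h A = eval_gword G f (SOME w. w \<in> A)" for A
  have h: "h (pres_class rels w) = eval_gword G f w" for w
  proof -
    have "w \<in> pres_class rels w" by (simp add: pres_class_def pres_refl)
    then have "(SOME v. v \<in> pres_class rels w) \<in> pres_class rels w" by (rule someI)
    then show ?thesis unfolding h_def using resp[of w] by (simp add: pres_class_def)
  qed
  then have "h \<in> hom (presented_group rels) G"
    by (auto simp: hom_def carrier_presented_group mult_presented_group append closed)
  with h show ?thesis by blast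
qed


section \<open>The extended Hecke group\<close>

datatype hecke_gen = RefP | RefQ | RefR

definition hecke_relators :: "nat \<Rightarrow> hecke_gen gword set" where
  "hecke_relators p =
    {[(True, RefP), (True, RefP)],
     [(True, RefQ), (True, RefQ)],
     [(True, RefR), (True, RefR)],
     concat (replicate 2 [(True, RefR), (True, RefP)]),
     concat (replicate p [(True, RefQ), (True, RefR)])}"

definition extended_hecke_group :: "nat \<Rightarrow> hecke_gen gword set monoid" where
  "extended_hecke_group p = presented_group (hecke_relators p)"


section \<open>Subgroups of given index and their conjugacy classes\<close>

text \<open>
  As \<open>card\<close> is \<open>0\<close> on infinite sets, this is the set of subgroups of index \<open>n\<close> only for \<open>n > 0\<close>.
\<close>

definition subgroups_of_index :: "('a, 'b) monoid_scheme \<Rightarrow> nat \<Rightarrow> 'a set set" where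
  "subgroups_of_index G n = {K. subgroup K G \<and> card (rcosets\<^bsub>G\<^esub> K) = n}"

definition subgroup_classes_of_index :: "('a, 'b) monoid_scheme \<Rightarrow> nat \<Rightarrow> 'a set set set" where
  "subgroup_classes_of_index G n =
    orbits G (subgroups_of_index G n)
      (\<lambda>g. \<lambda>K \<in> {K. subgroup K G}. g <#\<^bsub>G\<^esub> K #>\<^bsub>G\<^esub> inv\<^bsub>G\<^esub> g)"

end

theory Submission
  imports Defs "HOL-Algebra.Generated_Groups"
begin

text \<open>
  For \<open>n > 0\<close>, the subgroups of index \<open>n\<close> of a group \<open>G\<close> are the stabilizers of \<open>0\<close> in the transitive
  actions of \<open>G\<close> on \<open>{..<n}\<close> (\<open>subgroup_is_stabilizer\<close>, \<open>card_rcosets_stabilizer\<close>). Two actions have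
  the same stabilizer of \<open>0\<close> exactly if a relabelling of the points that fixes \<open>0\<close> turns one into
  the other (\<open>stabilizer_eq_iff_action_iso\<close>), and conjugate stabilizers exactly if some relabelling
  does (\<open>conjugate_stabilizers_iff_action_iso\<close>).

  An action of the extended Hecke group is a triple of permutations \<open>P\<close>, \<open>Q\<close>, \<open>R\<close> subject to the
  defining relations. A permutation of \<open>n\<close> points has order dividing \<open>p\<close> as soon as every positive \<open>k \<le> n\<close>
  divides \<open>p\<close> (\<open>funpow_eq_self_of_dvd\<close>). Under the divisibility hypotheses of the theorem the
  relation \<open>(QR)\<^sup>p = e\<close> is thus vacuous, and what remains is independent of \<open>p\<close>: three permutations
  with trivial squares, the first and the third commuting, that together act transitively
  (\<open>hecke_group_acts\<close>, \<open>hecke_action_relations\<close>).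

  The theorem is now a finite count (\<open>card_hecke_subgroups\<close>). On \<open>2\<close>, \<open>3\<close> and \<open>4\<close> points there are
  \<open>7\<close>, \<open>18\<close> and \<open>258\<close> such triples. They fall into \<open>7\<close> classes under relabellings that fix \<open>0\<close> when
  \<open>n = 2\<close>, where only the identity does, and into \<open>3\<close> and \<open>22\<close> classes under all relabellings
  when \<open>n = 3\<close> and \<open>n = 4\<close>. The triples are enumerated as lists of values and the classes are
  counted by rewriting.
\<close>

section \<open>Transitive actions and point stabilizers\<close>

text \<open>
  Bijectivity is automatic, since \<open>\<phi> (inv g)\<close> inverts \<open>\<phi> g\<close>. Extensionality is needed because the
  elements of \<open>BijGroup E\<close> are normalised outside \<open>E\<close>.
\<close>

lemma (in group) group_actionI:
  assumes ext: "\<And>g. g \<in> carrier G \<Longrightarrow> \<phi> g \<in> extensional E"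
    and closed: "\<And>g x. g \<in> carrier G \<Longrightarrow> x \<in> E \<Longrightarrow> \<phi> g x \<in> E"
    and one: "\<And>x. x \<in> E \<Longrightarrow> \<phi> \<one> x = x"
    and mult: "\<And>g h x. g \<in> carrier G \<Longrightarrow> h \<in> carrier G \<Longrightarrow> x \<in> E \<Longrightarrow> \<phi> (g \<otimes> h) x = \<phi> g (\<phi> h x)"
  shows "group_action G E \<phi>"
proof -
  have inverse: "\<phi> (inv g) (\<phi> g x) = x" "\<phi> g (\<phi> (inv g) x) = x"
    if "g \<in> carrier G" "x \<in> E" for g x
    using that mult[of "inv g" g x] mult[of g "inv g" x] one by simp_all
  have Bij: "\<phi> g \<in> Bij E" if g: "g \<in> carrier G" for g
  proof -
    have "bij_betw (\<phi> g) E E"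
      by (rule bij_betw_byWitness[where f' = "\<phi> (inv g)"]) (use g closed inverse in auto)
    then show ?thesis using ext[OF g] by (simp add: Bij_def)
  qed
  have "\<phi> (g \<otimes> h) = compose E (\<phi> g) (\<phi> h)" if "g \<in> carrier G" "h \<in> carrier G" for g h
    by (rule extensionalityI[of _ E]) (use that ext mult in \<open>auto simp: compose_def\<close>)
  then have "\<phi> \<in> hom G (BijGroup E)"
    using Bij by (auto simp: hom_def BijGroup_def)
  then show ?thesis
    by (simp add: group_action_def group_hom_def group_hom_axioms_def group_BijGroup is_group)
qed

lemma (in group_action) inverse_action:
  assumes "g \<in> carrier G" "x \<in> E"
  shows "\<phi> (inv g) (\<phi> g x) = x" "\<phi> g (\<phi> (inv g) x) = x"
proof -
  interpret group G using group_hom by (rule group_hom.axioms)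
  show "\<phi> (inv g) (\<phi> g x) = x" by (rule orbit_sym_aux[OF assms refl])
  show "\<phi> g (\<phi> (inv g) x) = x" using orbit_sym_aux[of "inv g" x] assms by simp
qed

lemma (in group_action) one_action: "x \<in> E \<Longrightarrow> \<phi> \<one> x = x"
  by (simp flip: id_eq_one)

text \<open>
  Translation of right cosets by \<open>inv g\<close> is a left action. It exhibits every subgroup as the
  stabilizer of a point, the coset \<open>K\<close> itself.
\<close>

lemma (in group) right_coset_action:
  assumes K: "subgroup K G"
  defines "\<rho> \<equiv> \<lambda>g. \<lambda>C\<in>rcosets K. C #> inv g"
  shows "transitive_action G (rcosets K) \<rho>" and "stabilizer G \<rho> K = K"
proof -
  interpret K: subgroup K G by (fact K)
  have K_coset: "K \<in> rcosets K" by (rule K.subgroup_in_rcosets[OF is_group])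
  have closed: "C #> g \<in> rcosets K" if "C \<in> rcosets K" "g \<in> carrier G" for C g
  proof -
    obtain a where "a \<in> carrier G" "C = K #> a" using \<open>C \<in> rcosets K\<close> by (auto simp: RCOSETS_def)
    then show ?thesis using that K.subset by (simp add: coset_mult_assoc rcosetsI)
  qed
  have sub: "C \<subseteq> carrier G" if "C \<in> rcosets K" for C
    using K.rcosets_carrier[OF is_group that] .
  have act: "group_action G (rcosets K) \<rho>"
    by (rule group_actionI)
      (auto simp: \<rho>_def closed sub coset_mult_assoc inv_mult_group)
  have "\<exists>g\<in>carrier G. \<rho> g C = D" if C: "C \<in> rcosets K" and D: "D \<in> rcosets K" for C D
  proof -
    obtain a where a: "a \<in> carrier G" "C = K #> a" using C by (auto simp: RCOSETS_def)
    obtain b where b: "b \<in> carrier G" "D = K #> b" using D by (auto simp: RCOSETS_def)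
    have "a \<otimes> inv (inv b \<otimes> a) = b" using a(1) b(1) by (simp add: inv_mult_group m_assoc[symmetric])
    then have "\<rho> (inv b \<otimes> a) C = D"
      using a b C K.subset by (simp add: \<rho>_def coset_mult_assoc)
    then show ?thesis using a b by blast
  qed
  with act show "transitive_action G (rcosets K) \<rho>"
    by (simp add: transitive_action_def transitive_action_axioms_def)
  have "K #> inv g = K \<longleftrightarrow> g \<in> K" if g: "g \<in> carrier G" for g
  proof -
    have "K #> inv g = K \<longleftrightarrow> inv g \<in> K"
      using coset_join1[OF _ _ K] coset_join2[OF _ K] inv_closed[OF g] by blast
    also have "\<dots> \<longleftrightarrow> g \<in> K"
      using K.m_inv_closed inv_inv[OF g] by metis
    finally show ?thesis .
  qed
  then show "stabilizer G \<rho> K = K"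
    using K.subset by (auto simp: stabilizer_def \<rho>_def K_coset)
qed

definition action_iso ::
  "('g, 'c) monoid_scheme \<Rightarrow> 'x set \<Rightarrow> ('g \<Rightarrow> 'x \<Rightarrow> 'x) \<Rightarrow> 'y set \<Rightarrow> ('g \<Rightarrow> 'y \<Rightarrow> 'y) \<Rightarrow> ('x \<Rightarrow> 'y) \<Rightarrow> bool"
  where "action_iso G E \<phi> F \<psi> \<sigma> \<longleftrightarrow>
    bij_betw \<sigma> E F \<and> (\<forall>g\<in>carrier G. \<forall>x\<in>E. \<sigma> (\<phi> g x) = \<psi> g (\<sigma> x))"

lemma (in group_action) stabilizer_action_iso:
  assumes \<sigma>: "action_iso G E \<phi> F \<psi> \<sigma>" and x: "x \<in> E"
  shows "stabilizer G \<psi> (\<sigma> x) = stabilizer G \<phi> x"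
proof -
  have "\<psi> g (\<sigma> x) = \<sigma> x \<longleftrightarrow> \<phi> g x = x" if g: "g \<in> carrier G" for g
  proof -
    have "\<psi> g (\<sigma> x) = \<sigma> (\<phi> g x)" using \<sigma> g x by (simp add: action_iso_def)
    then show ?thesis
      using \<sigma> x element_image[OF g x refl] by (auto simp: action_iso_def bij_betw_def inj_on_eq_iff)
  qed
  then show ?thesis by (auto simp: stabilizer_def)
qed

lemma (in transitive_action) transitive_action_transport:
  assumes \<beta>: "bij_betw \<beta> E F"
  obtains \<psi> where "transitive_action G F \<psi>" "action_iso G E \<phi> F \<psi> \<beta>"
proof -
  interpret group G using group_hom by (rule group_hom.axioms)
  define \<psi> where "\<psi> g = (\<lambda>y\<in>F. \<beta> (\<phi> g (inv_into E \<beta> y)))" for g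
  have pull: "inv_into E \<beta> y \<in> E" "\<beta> (inv_into E \<beta> y) = y" if "y \<in> F" for y
    using that \<beta> by (auto simp: bij_betw_def inv_into_into f_inv_into_f)
  have forth: "\<beta> x \<in> F" "inv_into E \<beta> (\<beta> x) = x" if "x \<in> E" for x
    using that \<beta> by (auto simp: bij_betw_def)
  have stay: "\<phi> g x \<in> E" if "g \<in> carrier G" "x \<in> E" for g x
    using element_image that by blast
  have act: "group_action G F \<psi>"
    by (rule group_actionI)
      (auto simp: \<psi>_def pull forth stay one_action composition_rule)
  have "\<exists>g\<in>carrier G. \<psi> g y = z" if "y \<in> F" "z \<in> F" for y z
    using unique_orbit[of "inv_into E \<beta> y" "inv_into E \<beta> z"] pull that by (auto simp: \<psi>_def) (metis pull(2))
  with act have "transitive_action G F \<psi>"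
    by (simp add: transitive_action_def transitive_action_axioms_def)
  moreover have "action_iso G E \<phi> F \<psi> \<beta>"
    using \<beta> by (simp add: action_iso_def \<psi>_def forth)
  ultimately show thesis by (rule that)
qed

text \<open>
  The point set and the base point can be prescribed: the action on the cosets of \<open>K\<close> is
  transported to \<open>E\<close> along a bijection that sends the coset \<open>K\<close> to \<open>x\<close>. Fixing the point set in
  advance is what makes the subgroups of given index a finite combinatorial datum.
\<close>

lemma (in group) subgroup_is_stabilizer:
  assumes K: "subgroup K G" and card: "card (rcosets K) = card E" and E: "finite E" "x \<in> E"
  obtains \<phi> where "transitive_action G E \<phi>" "stabilizer G \<phi> x = K"
proof -
  interpret K: subgroup K G by (fact K)
  define \<rho> where "\<rho> = (\<lambda>g. \<lambda>C\<in>rcosets K. C #> inv g)"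
  interpret \<rho>: transitive_action G "rcosets K" \<rho>
    unfolding \<rho>_def by (rule right_coset_action(1)[OF K])
  have KC: "K \<in> rcosets K" by (rule K.subgroup_in_rcosets[OF is_group])
  have fin: "finite (rcosets K)" using card E by (metis card_eq_0_iff empty_iff)
  \<comment> \<open>A bijection away from the base points, extended by \<open>K \<mapsto> x\<close>.\<close>
  have "card (rcosets K - {K}) = card (E - {x})" using card E KC by simp
  then obtain \<gamma> where "bij_betw \<gamma> (rcosets K - {K}) (E - {x})"
    using finite_same_card_bij[of "rcosets K - {K}" "E - {x}"] fin E by auto
  then have "bij_betw (\<gamma>(K := x)) (rcosets K - {K} \<union> {K}) (E - {x} \<union> {x})"
    by (intro bij_betw_combine) (auto simp: bij_betw_def inj_on_def)
  then have "bij_betw (\<gamma>(K := x)) (rcosets K) E"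
    using KC E by (simp add: insert_absorb)
  then obtain \<psi> where \<psi>: "transitive_action G E \<psi>" "action_iso G (rcosets K) \<rho> E \<psi> (\<gamma>(K := x))"
    by (rule \<rho>.transitive_action_transport)
  have "stabilizer G \<psi> x = K"
    using \<rho>.stabilizer_action_iso[OF \<psi>(2) KC] right_coset_action(2)[OF K] by (simp add: \<rho>_def)
  with \<psi>(1) show thesis by (rule that)
qed

lemma (in transitive_action) card_rcosets_stabilizer:
  assumes "x \<in> E"
  shows "card (rcosets (stabilizer G \<phi> x)) = card E"
proof -
  have "orbit G \<phi> x = E"
    using unique_orbit[OF assms] element_image[OF _ assms] by (fastforce simp: orbit_def)
  then show ?thesis
    using bij_betw_same_card[OF orbit_stab_fun_is_bij[OF assms]] by simp
qed

lemma (in group_action) same_image_iff: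
  assumes "g \<in> carrier G" "h \<in> carrier G" "x \<in> E"
  shows "\<phi> g x = \<phi> h x \<longleftrightarrow> inv g \<otimes> h \<in> stabilizer G \<phi> x"
proof -
  interpret group G using group_hom by (rule group_hom.axioms)
  have E: "\<phi> h x \<in> E" using assms element_image by blast
  have "\<phi> (inv g \<otimes> h) x = \<phi> (inv g) (\<phi> h x)" using assms by (simp add: composition_rule)
  moreover have "\<phi> (inv g) (\<phi> h x) = x \<longleftrightarrow> \<phi> h x = \<phi> g x"
    using inverse_action[of g] assms E by metis
  ultimately show ?thesis using assms by (auto simp: stabilizer_def)
qed

text \<open>
  In a transitive action every point has the form \<open>\<phi> g x\<close>, and the stabilizer of \<open>x\<close> decides when
  two such points coincide. If the stabilizers agree, \<open>\<phi> g x \<mapsto> \<psi> g y\<close> is therefore well defined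
  and bijective, and it is equivariant by construction.
\<close>

lemma stabilizer_eq_iff_action_iso:
  fixes G :: "('g, 'c) monoid_scheme" (structure)
  assumes "transitive_action G E \<phi>" "transitive_action G F \<psi>" and x: "x \<in> E" and y: "y \<in> F"
  shows "stabilizer G \<phi> x = stabilizer G \<psi> y \<longleftrightarrow> (\<exists>\<sigma>. action_iso G E \<phi> F \<psi> \<sigma> \<and> \<sigma> x = y)"
proof
  interpret \<phi>: transitive_action G E \<phi> by fact
  interpret \<psi>: transitive_action G F \<psi> by fact
  interpret group G using \<phi>.group_hom by (rule group_hom.axioms)
  assume stab: "stabilizer G \<phi> x = stabilizer G \<psi> y"
  have same: "\<phi> g x = \<phi> h x \<longleftrightarrow> \<psi> g y = \<psi> h y" if "g \<in> carrier G" "h \<in> carrier G" for g h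
    using that by (simp add: \<phi>.same_image_iff \<psi>.same_image_iff x y stab)
  define \<sigma> where "\<sigma> e = \<psi> (SOME g. g \<in> carrier G \<and> \<phi> g x = e) y" for e
  have \<sigma>: "\<sigma> (\<phi> g x) = \<psi> g y" if g: "g \<in> carrier G" for g
  proof -
    define h where "h = (SOME h. h \<in> carrier G \<and> \<phi> h x = \<phi> g x)"
    have "h \<in> carrier G \<and> \<phi> h x = \<phi> g x"
      unfolding h_def by (rule someI[of _ g]) (use g in simp)
    then show ?thesis using same[of h g] g by (simp add: \<sigma>_def flip: h_def)
  qed
  have E: "\<exists>g\<in>carrier G. e = \<phi> g x" if "e \<in> E" for e using \<phi>.unique_orbit[OF x that] by blast
  have F: "\<exists>g\<in>carrier G. e = \<psi> g y" if "e \<in> F" for e using \<psi>.unique_orbit[OF y that] by blast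
  have "inj_on \<sigma> E" by (rule inj_onI) (use E \<sigma> same in metis)
  moreover have "\<sigma> ` E = F"
  proof
    show "\<sigma> ` E \<subseteq> F" using E \<sigma> \<psi>.element_image[OF _ y] by fastforce
    show "F \<subseteq> \<sigma> ` E" using F \<sigma> \<phi>.element_image[OF _ x] by (metis image_eqI subsetI)
  qed
  ultimately have "bij_betw \<sigma> E F" by (simp add: bij_betw_def)
  moreover have "\<sigma> (\<phi> g e) = \<psi> g (\<sigma> e)" if "g \<in> carrier G" "e \<in> E" for g e
  proof -
    obtain h where "h \<in> carrier G" "e = \<phi> h x" using E[OF \<open>e \<in> E\<close>] by blast
    then show ?thesis
      using that \<sigma>[of "g \<otimes> h"] \<sigma>[of h]
      by (simp add: \<phi>.composition_rule \<psi>.composition_rule x y)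
  qed
  moreover have "\<sigma> x = y"
    using \<sigma>[OF one_closed] by (simp add: \<phi>.one_action \<psi>.one_action x y)
  ultimately show "\<exists>\<sigma>. action_iso G E \<phi> F \<psi> \<sigma> \<and> \<sigma> x = y"
    by (auto simp: action_iso_def)
next
  interpret \<phi>: transitive_action G E \<phi> by fact
  show "\<exists>\<sigma>. action_iso G E \<phi> F \<psi> \<sigma> \<and> \<sigma> x = y \<Longrightarrow> stabilizer G \<phi> x = stabilizer G \<psi> y"
    using \<phi>.stabilizer_action_iso[OF _ x] by blast
qed

lemma (in group_action) stabilizer_conjugate:
  assumes g: "g \<in> carrier G" and x: "x \<in> E"
  shows "stabilizer G \<phi> (\<phi> g x) = g <# stabilizer G \<phi> x #> inv g"
proof -
  interpret group G using group_hom by (rule group_hom.axioms)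
  have gx: "\<phi> g x \<in> E" using element_image[OF g x] by simp
  have stab: "h \<in> stabilizer G \<phi> (\<phi> g x) \<longleftrightarrow> inv g \<otimes> h \<otimes> g \<in> stabilizer G \<phi> x"
    if h: "h \<in> carrier G" for h
    using same_image_iff[of g "h \<otimes> g" x] g h x
    by (auto simp: stabilizer_def composition_rule m_assoc)
  have conj: "h \<in> g <# S #> inv g \<longleftrightarrow> inv g \<otimes> h \<otimes> g \<in> S"
    if h: "h \<in> carrier G" and S: "S \<subseteq> carrier G" for h S
  proof
    assume "h \<in> g <# S #> inv g"
    then obtain s where s: "s \<in> S" "h = g \<otimes> s \<otimes> inv g" by (auto simp: l_coset_def r_coset_def)
    then have "inv g \<otimes> h \<otimes> g = s" using g subsetD[OF S s(1)] by (simp add: m_assoc inv_solve_left')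
    with s show "inv g \<otimes> h \<otimes> g \<in> S" by simp
  next
    assume *: "inv g \<otimes> h \<otimes> g \<in> S"
    have "h = g \<otimes> (inv g \<otimes> h \<otimes> g) \<otimes> inv g" using g h by (simp add: conjugation_is_surj)
    with * show "h \<in> g <# S #> inv g" by (force simp: l_coset_def r_coset_def)
  qed
  have sub: "g <# stabilizer G \<phi> x #> inv g \<subseteq> carrier G"
    using g stabilizer_subset by (meson inv_closed l_coset_subset_G r_coset_subset_G)
  show ?thesis
  proof (rule Set.set_eqI)
    fix h
    show "h \<in> stabilizer G \<phi> (\<phi> g x) \<longleftrightarrow> h \<in> g <# stabilizer G \<phi> x #> inv g"
    proof (cases "h \<in> carrier G")
      case True
      then show ?thesis using stab conj[OF True stabilizer_subset] by simp
    next
      case False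
      then show ?thesis using sub stabilizer_subset[of "\<phi> g x"] by auto
    qed
  qed
qed

text \<open>
  Conjugating the stabilizer of a point amounts to moving the point, so up to conjugacy the base
  points no longer matter: the conjugacy class of the stabilizer determines the transitive action
  up to isomorphism, and conversely.
\<close>

lemma conjugate_stabilizers_iff_action_iso:
  fixes G :: "('g, 'c) monoid_scheme" (structure)
  assumes "transitive_action G E \<phi>" "transitive_action G F \<psi>" and x: "x \<in> E" and y: "y \<in> F"
  defines "\<kappa> \<equiv> \<lambda>g. \<lambda>K\<in>{K. subgroup K G}. g <# K #> inv g"
  shows "orbit G \<kappa> (stabilizer G \<phi> x) = orbit G \<kappa> (stabilizer G \<psi> y)
    \<longleftrightarrow> (\<exists>\<sigma>. action_iso G E \<phi> F \<psi> \<sigma>)"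
proof -
  interpret \<phi>: transitive_action G E \<phi> by fact
  interpret \<psi>: transitive_action G F \<psi> by fact
  interpret group G using \<phi>.group_hom by (rule group_hom.axioms)
  interpret \<kappa>: group_action G "{K. subgroup K G}" \<kappa>
    unfolding \<kappa>_def by (rule action_by_conjugation_on_subgroups_set)
  have sub: "stabilizer G \<phi> x \<in> {K. subgroup K G}" "stabilizer G \<psi> y \<in> {K. subgroup K G}"
    using \<phi>.stabilizer_subgroup[OF x] \<psi>.stabilizer_subgroup[OF y] by auto
  have conj: "\<kappa> g (stabilizer G \<phi> x) = stabilizer G \<phi> (\<phi> g x)" if "g \<in> carrier G" for g
    using sub \<phi>.stabilizer_conjugate[OF that x] by (simp add: \<kappa>_def)
  have iso: "(\<exists>g\<in>carrier G. stabilizer G \<phi> (\<phi> g x) = stabilizer G \<psi> y)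
    \<longleftrightarrow> (\<exists>\<sigma>. action_iso G E \<phi> F \<psi> \<sigma>)"
  proof
    assume "\<exists>g\<in>carrier G. stabilizer G \<phi> (\<phi> g x) = stabilizer G \<psi> y"
    then show "\<exists>\<sigma>. action_iso G E \<phi> F \<psi> \<sigma>"
      using stabilizer_eq_iff_action_iso[OF assms(1,2) _ y] \<phi>.element_image[OF _ x refl] by blast
  next
    assume "\<exists>\<sigma>. action_iso G E \<phi> F \<psi> \<sigma>"
    then obtain \<sigma> where \<sigma>: "action_iso G E \<phi> F \<psi> \<sigma>" by blast
    then obtain e where e: "e \<in> E" "\<sigma> e = y" using y by (auto simp: action_iso_def bij_betw_def)
    then obtain g where "g \<in> carrier G" "\<phi> g x = e" using \<phi>.unique_orbit[OF x] by blast
    then show "\<exists>g\<in>carrier G. stabilizer G \<phi> (\<phi> g x) = stabilizer G \<psi> y"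
      using \<phi>.stabilizer_action_iso[OF \<sigma> e(1)] e by auto
  qed
  have "orbit G \<kappa> (stabilizer G \<phi> x) = orbit G \<kappa> (stabilizer G \<psi> y)
    \<longleftrightarrow> stabilizer G \<psi> y \<in> orbit G \<kappa> (stabilizer G \<phi> x)"
  proof
    assume "orbit G \<kappa> (stabilizer G \<phi> x) = orbit G \<kappa> (stabilizer G \<psi> y)"
    then show "stabilizer G \<psi> y \<in> orbit G \<kappa> (stabilizer G \<phi> x)"
      using \<kappa>.orbit_refl[OF sub(2)] by simp
  next
    assume "stabilizer G \<psi> y \<in> orbit G \<kappa> (stabilizer G \<phi> x)"
    then have "orbit G \<kappa> (stabilizer G \<phi> x) \<inter> orbit G \<kappa> (stabilizer G \<psi> y) \<noteq> {}"
      using \<kappa>.orbit_refl[OF sub(2)] by blast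
    then show "orbit G \<kappa> (stabilizer G \<phi> x) = orbit G \<kappa> (stabilizer G \<psi> y)"
      using \<kappa>.disjoint_union sub by (auto simp: orbits_def)
  qed
  also have "\<dots> \<longleftrightarrow> (\<exists>g\<in>carrier G. stabilizer G \<phi> (\<phi> g x) = stabilizer G \<psi> y)"
    using conj by (auto simp: orbit_def)
  finally show ?thesis using iso by simp
qed

text \<open>
  The elements at which \<open>\<sigma>\<close> is equivariant form a subgroup, so the generators suffice.
\<close>

lemma action_iso_generators:
  fixes G :: "('g, 'c) monoid_scheme" (structure)
  assumes "group_action G E \<phi>" "group_action G F \<psi>" and S: "generate G S = carrier G"
    and \<sigma>: "bij_betw \<sigma> E F" and gen: "\<And>s x. s \<in> S \<Longrightarrow> x \<in> E \<Longrightarrow> \<sigma> (\<phi> s x) = \<psi> s (\<sigma> x)"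
  shows "action_iso G E \<phi> F \<psi> \<sigma>"
proof -
  interpret \<phi>: group_action G E \<phi> by fact
  interpret \<psi>: group_action G F \<psi> by fact
  interpret group G using \<phi>.group_hom by (rule group_hom.axioms)
  have F: "\<sigma> x \<in> F" if "x \<in> E" for x using \<sigma> that by (auto simp: bij_betw_def)
  have stay: "\<phi> g x \<in> E" if "g \<in> carrier G" "x \<in> E" for g x using \<phi>.element_image that by blast
  have "\<forall>x\<in>E. \<sigma> (\<phi> g x) = \<psi> g (\<sigma> x)" if "g \<in> generate G S" for g
    using that
  proof (induction rule: generate.induct)
    case one
    then show ?case using F by (simp add: \<phi>.one_action \<psi>.one_action)
  next
    case (incl s)
    then show ?case using gen by simp
  next
    case (inv s)
    then have s: "s \<in> carrier G" using generate.incl[of s S G] S by simp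
    show ?case
    proof
      fix x assume x: "x \<in> E"
      have "\<sigma> x = \<psi> s (\<sigma> (\<phi> (inv s) x))"
        using gen[OF inv stay[of "inv s" x]] s x by (simp add: \<phi>.inverse_action)
      then show "\<sigma> (\<phi> (inv s) x) = \<psi> (inv s) (\<sigma> x)"
        using s x F stay[of "inv s" x] by (simp add: \<psi>.inverse_action)
    qed
  next
    case (eng g h)
    then have "g \<in> carrier G" "h \<in> carrier G" using S by auto
    then show ?case using eng.IH stay F by (simp add: \<phi>.composition_rule \<psi>.composition_rule)
  qed
  then show ?thesis using \<sigma> S by (simp add: action_iso_def)
qed

text \<open>
  Only forward invariance under the generators is demanded. On a finite set this already gives
  invariance under their inverses, because an injective self-map of a finite set is onto.
\<close>

lemma (in group_action) transitive_iff_no_invariant_subset: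
  assumes S: "generate G S = carrier G" and E: "finite E" "x \<in> E"
  shows "transitive_action G E \<phi> \<longleftrightarrow>
    (\<forall>A\<subseteq>E. x \<in> A \<and> (\<forall>s\<in>S. \<forall>a\<in>A. \<phi> s a \<in> A) \<longrightarrow> A = E)"
proof
  interpret group G using group_hom by (rule group_hom.axioms)
  assume "transitive_action G E \<phi>"
  then interpret transitive_action G E \<phi> .
  show "\<forall>A\<subseteq>E. x \<in> A \<and> (\<forall>s\<in>S. \<forall>a\<in>A. \<phi> s a \<in> A) \<longrightarrow> A = E"
  proof (intro allI impI)
    fix A assume A: "A \<subseteq> E" and *: "x \<in> A \<and> (\<forall>s\<in>S. \<forall>a\<in>A. \<phi> s a \<in> A)"
    have "\<forall>a\<in>A. \<phi> g a \<in> A" if "g \<in> generate G S" for g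
      using that
    proof (induction rule: generate.induct)
      case one
      then show ?case using A by (auto simp: one_action)
    next
      case (incl s)
      then show ?case using * by simp
    next
      case (inv s)
      then have s: "s \<in> carrier G" using generate.incl[of s S G] S by simp
      have "inj_on (\<phi> s) A" using inj_prop[OF s] A by (rule inj_on_subset)
      moreover have "\<phi> s ` A \<subseteq> A" using * inv by blast
      ultimately have "\<phi> s ` A = A" using A E(1) by (meson endo_inj_surj finite_subset)
      then have "\<exists>b\<in>A. a = \<phi> s b" if "a \<in> A" for a using that by blast
      then show ?case using s A inverse_action(1)[OF s] by force
    next
      case (eng g h)
      then have "g \<in> carrier G" "h \<in> carrier G" using S by auto
      then show ?case using eng.IH A by (auto simp: composition_rule)
    qed
    then have closed: "\<phi> g x \<in> A" if "g \<in> carrier G" for g using * S that by auto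
    have "e \<in> A" if "e \<in> E" for e using unique_orbit[OF E(2) that] closed by auto
    with A show "A = E" by blast
  qed
next
  interpret group G using group_hom by (rule group_hom.axioms)
  assume closed: "\<forall>A\<subseteq>E. x \<in> A \<and> (\<forall>s\<in>S. \<forall>a\<in>A. \<phi> s a \<in> A) \<longrightarrow> A = E"
  have "\<phi> s a \<in> orbit G \<phi> x" if s: "s \<in> S" and a: "a \<in> orbit G \<phi> x" for s a
  proof -
    obtain g where "g \<in> carrier G" "a = \<phi> g x" using a by (auto simp: orbit_def)
    then have "\<phi> s a = \<phi> (s \<otimes> g) x" "s \<otimes> g \<in> carrier G"
      using s S E(2) generate.incl[of s S G] by (auto simp: composition_rule)
    then show ?thesis by (auto simp: orbit_def)
  qed
  moreover have "orbit G \<phi> x \<subseteq> E" using element_image[OF _ E(2)] by (auto simp: orbit_def)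
  ultimately have orb: "orbit G \<phi> x = E" using closed orbit_refl[OF E(2)] by blast
  have "\<exists>g\<in>carrier G. \<phi> g y = z" if yz: "y \<in> E" "z \<in> E" for y z
  proof -
    have "z \<in> orbit G \<phi> y"
      using orbit_trans[OF yz(1) E(2) yz(2) orbit_sym[OF E(2) yz(1)]] yz orb by simp
    then show ?thesis by (auto simp: orbit_def)
  qed
  then show "transitive_action G E \<phi>"
    by (simp add: transitive_action_def transitive_action_axioms_def group_action_axioms)
qed

section \<open>Generators of a presented group\<close>

lemma generate_presented_group:
  "generate (presented_group rels) (range (\<lambda>x. pres_class rels [(True, x)])) =
    carrier (presented_group rels)"
    (is "generate ?G ?S = _")
proof
  interpret group ?G by (rule group_presented_group)
  show "generate ?G ?S \<subseteq> carrier ?G"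
    by (rule generate_incl) (auto simp: carrier_presented_group)
  have "pres_class rels w \<in> generate ?G ?S" for w
  proof (induction w)
    case Nil
    show ?case using generate.one[of ?G ?S] by (simp add: one_presented_group)
  next
    case (Cons a w)
    obtain b x where a: "a = (b, x)" by (cases a)
    have inv: "inv\<^bsub>?G\<^esub> pres_class rels [(True, x)] = pres_class rels [(False, x)]"
    proof (rule inv_equality)
      show "pres_class rels [(False, x)] \<otimes>\<^bsub>?G\<^esub> pres_class rels [(True, x)] = \<one>\<^bsub>?G\<^esub>"
        using pres_cancel[of rels "[]" False x "[]"]
        by (simp add: mult_presented_group one_presented_group pres_class_eq_iff)
    qed (simp_all add: carrier_presented_group)
    have "pres_class rels [(True, x)] \<in> generate ?G ?S" by (rule generate.incl) blast
    moreover have "pres_class rels [(False, x)] \<in> generate ?G ?S"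
      unfolding inv[symmetric] by (rule generate.inv) blast
    ultimately have "pres_class rels [a] \<in> generate ?G ?S" by (cases b) (simp_all add: a)
    from generate.eng[OF this Cons.IH] show ?case by (simp add: mult_presented_group)
  qed
  then show "carrier ?G \<subseteq> generate ?G ?S" by (auto simp: carrier_presented_group)
qed

section \<open>Actions of the extended Hecke group\<close>

definition hecke_elem :: "nat \<Rightarrow> hecke_gen \<Rightarrow> hecke_gen gword set" where
  "hecke_elem p x = pres_class (hecke_relators p) [(True, x)]"

lemma group_extended_hecke_group: "group (extended_hecke_group p)"
  by (simp add: extended_hecke_group_def group_presented_group)

lemma hecke_elem_carrier: "hecke_elem p x \<in> carrier (extended_hecke_group p)"
  by (simp add: hecke_elem_def extended_hecke_group_def carrier_presented_group)

lemma generate_hecke_elem: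
  "generate (extended_hecke_group p) (range (hecke_elem p)) = carrier (extended_hecke_group p)"
  using generate_presented_group[of "hecke_relators p"]
  by (simp add: extended_hecke_group_def hecke_elem_def[abs_def])

text \<open>
  Every cycle of a permutation of \<open>X\<close> has some length \<open>k \<le> card X\<close>. This is where the divisibility
  hypotheses on \<open>p\<close> enter: if all such \<open>k\<close> divide \<open>p\<close>, then the relation \<open>(QR)\<^sup>p = e\<close> holds for any
  two permutations of \<open>X\<close> and imposes nothing.
\<close>

lemma funpow_eq_self_of_dvd:
  assumes X: "finite X" "bij_betw f X X" and dvd: "\<And>k. 1 \<le> k \<Longrightarrow> k \<le> card X \<Longrightarrow> k dvd m"
    and x: "x \<in> X"
  shows "(f ^^ m) x = x"
proof -
  have bij: "bij_betw (f ^^ k) X X" for k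
    by (rule bij_betw_funpow[OF X(2)])
  then have stay: "(f ^^ k) x \<in> X" for k using x bij_betwE by blast
  \<comment> \<open>Pigeonhole: the first \<open>card X + 1\<close> points of the orbit of \<open>x\<close> repeat.\<close>
  have "card ((\<lambda>k. (f ^^ k) x) ` {..card X}) \<le> card X"
    using stay by (intro card_mono[OF X(1)]) auto
  then have "\<not> inj_on (\<lambda>k. (f ^^ k) x) {..card X}" by (intro pigeonhole) simp
  then obtain i j where ij: "i < j" "j \<le> card X" "(f ^^ i) x = (f ^^ j) x"
    by (auto simp: inj_on_def) (metis linorder_neqE_nat)
  have "(f ^^ i) ((f ^^ (j - i)) x) = (f ^^ i) x"
    using ij by (simp flip: funpow_add comp_apply[of "f ^^ i"])
  then have cycle: "(f ^^ (j - i)) x = x"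
    using bij[of i] stay x by (auto simp: bij_betw_def inj_on_eq_iff)
  have "j - i dvd m" using dvd[of "j - i"] ij by simp
  then obtain d where d: "m = (j - i) * d" by blast
  have "(((f ^^ (j - i)) ^^ d)) x = x" by (induction d) (simp_all add: cycle)
  then show ?thesis by (simp add: d funpow_mult)
qed

lemma mult_BijGroup: "a \<in> Bij X \<Longrightarrow> b \<in> Bij X \<Longrightarrow> a \<otimes>\<^bsub>BijGroup X\<^esub> b = compose X a b"
  by (simp add: BijGroup_def)

lemma carrier_BijGroup: "carrier (BijGroup X) = Bij X"
  by (simp add: BijGroup_def)

lemma pow_BijGroup:
  assumes a: "a \<in> Bij X" and x: "x \<in> X"
  shows "(a [^]\<^bsub>BijGroup X\<^esub> (k::nat)) x = (a ^^ k) x"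
  using x
proof (induction k arbitrary: x)
  case 0
  then show ?case by (simp add: BijGroup_def)
next
  case (Suc k)
  interpret group "BijGroup X" by (rule group_BijGroup)
  have "a [^]\<^bsub>BijGroup X\<^esub> k \<in> Bij X" using nat_pow_closed[of a k] a by (simp add: carrier_BijGroup)
  moreover have "a x \<in> X" using Bij_imp_funcset[OF a] Suc.prems by blast
  ultimately show ?case
    using Suc a by (simp add: mult_BijGroup compose_eq funpow_swap1)
qed

lemma (in group) eval_gword_power:
  assumes "\<And>x. f x \<in> carrier G"
  shows "eval_gword G f (concat (replicate k [(True, x), (True, y)])) = (f x \<otimes> f y) [^] k"
proof (induction k)
  case (Suc k)
  then show ?case using assms nat_pow_Suc2[of "f x \<otimes> f y" k] by (simp add: m_assoc)
qed simp

text \<open>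
  By the universal property, permutations \<open>f x\<close> of \<open>X\<close> that satisfy the relations define an action.
  The relation \<open>(RP)\<^sup>2 = e\<close> for involutions says that \<open>R\<close> and \<open>P\<close> commute, and \<open>(QR)\<^sup>p = e\<close> holds
  automatically.
\<close>

lemma hecke_group_acts:
  fixes f :: "hecke_gen \<Rightarrow> 'x \<Rightarrow> 'x"
  assumes X: "finite X" and dvd: "\<And>k. 1 \<le> k \<Longrightarrow> k \<le> card X \<Longrightarrow> k dvd p"
    and stay: "\<And>x i. i \<in> X \<Longrightarrow> f x i \<in> X"
    and invol: "\<And>x i. i \<in> X \<Longrightarrow> f x (f x i) = i"
    and comm: "\<And>i. i \<in> X \<Longrightarrow> f RefP (f RefR i) = f RefR (f RefP i)"
  obtains \<phi> where "group_action (extended_hecke_group p) X \<phi>"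
    and "\<And>x i. i \<in> X \<Longrightarrow> \<phi> (hecke_elem p x) i = f x i"
proof -
  interpret B: group "BijGroup X" by (rule group_BijGroup)
  define F where "F x = restrict (f x) X" for x
  have F: "F x \<in> Bij X" for x
  proof -
    have "bij_betw (F x) X X"
      by (rule bij_betw_byWitness[where f' = "f x"]) (auto simp: F_def stay invol)
    then show ?thesis by (simp add: Bij_def F_def)
  qed
  then have F': "F x \<in> carrier (BijGroup X)" for x by (simp add: carrier_BijGroup)
  have mult: "(F x \<otimes>\<^bsub>BijGroup X\<^esub> F y) i = f x (f y i)" if "i \<in> X" for x y i
    using that by (simp add: mult_BijGroup F compose_eq) (simp add: F_def stay)
  have one: "a = \<one>\<^bsub>BijGroup X\<^esub>" if "a \<in> Bij X" "\<And>i. i \<in> X \<Longrightarrow> a i = i" for a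
    using that by (auto simp: BijGroup_def Bij_def intro!: extensionalityI[of _ X])
  have pow: "(F x \<otimes>\<^bsub>BijGroup X\<^esub> F y) [^]\<^bsub>BijGroup X\<^esub> k = \<one>\<^bsub>BijGroup X\<^esub>"
    if cycle: "\<And>i. i \<in> X \<Longrightarrow> ((F x \<otimes>\<^bsub>BijGroup X\<^esub> F y) ^^ k) i = i" for x y and k :: nat
  proof (rule one)
    have closed: "F x \<otimes>\<^bsub>BijGroup X\<^esub> F y \<in> carrier (BijGroup X)" using F' by simp
    then show "(F x \<otimes>\<^bsub>BijGroup X\<^esub> F y) [^]\<^bsub>BijGroup X\<^esub> k \<in> Bij X"
      using B.nat_pow_closed by (simp flip: carrier_BijGroup)
    show "((F x \<otimes>\<^bsub>BijGroup X\<^esub> F y) [^]\<^bsub>BijGroup X\<^esub> k) i = i" if "i \<in> X" for i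
      using closed cycle[OF that] that by (simp add: pow_BijGroup carrier_BijGroup)
  qed
  have square: "F x \<otimes>\<^bsub>BijGroup X\<^esub> F x = \<one>\<^bsub>BijGroup X\<^esub>" for x
    by (rule one) (use F' B.m_closed in \<open>auto simp: mult invol simp flip: carrier_BijGroup\<close>)
  have "(F RefR \<otimes>\<^bsub>BijGroup X\<^esub> F RefP) [^]\<^bsub>BijGroup X\<^esub> (2::nat) = \<one>\<^bsub>BijGroup X\<^esub>"
    by (rule pow) (simp add: numeral_2_eq_2 mult stay comm invol)
  moreover have "(F RefQ \<otimes>\<^bsub>BijGroup X\<^esub> F RefR) [^]\<^bsub>BijGroup X\<^esub> p = \<one>\<^bsub>BijGroup X\<^esub>"
  proof (rule pow)
    have "F RefQ \<otimes>\<^bsub>BijGroup X\<^esub> F RefR \<in> Bij X" using F' by (simp flip: carrier_BijGroup)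
    then show "((F RefQ \<otimes>\<^bsub>BijGroup X\<^esub> F RefR) ^^ p) i = i" if "i \<in> X" for i
      by (intro funpow_eq_self_of_dvd[OF X _ dvd that]) (auto simp: Bij_def)
  qed
  ultimately have rels: "eval_gword (BijGroup X) F r = \<one>\<^bsub>BijGroup X\<^esub>"
    if "r \<in> hecke_relators p" for r
    using that unfolding hecke_relators_def
    by (auto simp: B.eval_gword_power[OF F'] F' square simp del: replicate.simps)
  obtain \<phi> where \<phi>: "\<phi> \<in> hom (extended_hecke_group p) (BijGroup X)"
    "\<And>w. \<phi> (pres_class (hecke_relators p) w) = eval_gword (BijGroup X) F w"
    using presented_group_universal[OF group_BijGroup F' rels] unfolding extended_hecke_group_def
    by blast
  show thesis
  proof (rule that)
    show "group_action (extended_hecke_group p) X \<phi>"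
      using \<phi>(1) by (simp add: group_action_def group_hom_def group_hom_axioms_def group_BijGroup
          group_extended_hecke_group)
    show "\<phi> (hecke_elem p x) i = f x i" if "i \<in> X" for x i
      using that F' by (simp add: hecke_elem_def \<phi>(2)) (simp add: F_def)
  qed
qed

lemma hecke_action_relations:
  assumes "group_action (extended_hecke_group p) X \<phi>" and i: "i \<in> X"
  shows "\<phi> (hecke_elem p x) (\<phi> (hecke_elem p x) i) = i"
    and "\<phi> (hecke_elem p RefP) (\<phi> (hecke_elem p RefR) i) =
      \<phi> (hecke_elem p RefR) (\<phi> (hecke_elem p RefP) i)"
proof -
  interpret group_action "extended_hecke_group p" X \<phi> by fact
  interpret group "extended_hecke_group p" by (rule group_extended_hecke_group)
  let ?f = "\<lambda>x. \<phi> (hecke_elem p x)"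
  have stay: "?f x i \<in> X" if "i \<in> X" for x i using element_image[OF hecke_elem_carrier that] by simp
  have mult: "\<phi> (hecke_elem p x \<otimes>\<^bsub>extended_hecke_group p\<^esub> g) i = ?f x (\<phi> g i)"
    if "g \<in> carrier (extended_hecke_group p)" "i \<in> X" for x g i
    using composition_rule[OF that(2) hecke_elem_carrier that(1)] .
  have "hecke_elem p x \<otimes>\<^bsub>extended_hecke_group p\<^esub> hecke_elem p x = \<one>\<^bsub>extended_hecke_group p\<^esub>" for x
    using relator_presented_group[of "[(True, x), (True, x)]" "hecke_relators p"]
    by (cases x) (simp_all add: hecke_elem_def extended_hecke_group_def mult_presented_group hecke_relators_def)
  then have invol: "?f x (?f x i) = i" if "i \<in> X" for x i
    using that mult[OF hecke_elem_carrier that, of x x] by (simp add: one_action)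
  then show "?f x (?f x i) = i" using i .
  let ?R = "hecke_elem p RefR" and ?P = "hecke_elem p RefP"
  have "?R \<otimes>\<^bsub>extended_hecke_group p\<^esub> (?P \<otimes>\<^bsub>extended_hecke_group p\<^esub>
      (?R \<otimes>\<^bsub>extended_hecke_group p\<^esub> ?P)) = \<one>\<^bsub>extended_hecke_group p\<^esub>"
    using relator_presented_group[of "concat (replicate 2 [(True, RefR), (True, RefP)])" "hecke_relators p"]
    by (simp add: hecke_elem_def extended_hecke_group_def mult_presented_group hecke_relators_def numeral_2_eq_2)
  then have "?f RefR (?f RefP (?f RefR (?f RefP i))) = i"
    using i by (simp add: one_action hecke_elem_carrier flip: mult)
  \<comment> \<open>Applying \<open>PR\<close> to \<open>RPRP = e\<close> cancels the first two letters and leaves \<open>RP = PR\<close>.\<close>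
  then have "?f RefP (?f RefR (?f RefR (?f RefP (?f RefR (?f RefP i))))) = ?f RefP (?f RefR i)"
    by simp
  then show "?f RefP (?f RefR i) = ?f RefR (?f RefP i)" using i by (simp add: stay invol)
qed

section \<open>Tables of generators\<close>

text \<open>
  The permutation of \<open>{..<n}\<close> by a generator is stored as the list of its values. A triple lists
  the tables of \<open>P\<close>, \<open>Q\<close> and \<open>R\<close> in this order. Quantifiers over points, subsets and relabellings
  range over lists in the definitions below, so that rewriting can evaluate them.
\<close>

type_synonym table_triple = "nat list \<times> nat list \<times> nat list"

fun table_of :: "table_triple \<Rightarrow> hecke_gen \<Rightarrow> nat list" where
  "table_of (a, b, c) RefP = a"
| "table_of (a, b, c) RefQ = b"
| "table_of (a, b, c) RefR = c"

definition involution_tables :: "nat \<Rightarrow> nat list list" where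
  "involution_tables n =
    filter (\<lambda>a. \<forall>i\<in>set [0..<n]. a ! (a ! i) = i) (List.n_lists n [0..<n])"

definition permutation_tables :: "nat \<Rightarrow> nat list list" where
  "permutation_tables n = filter distinct (List.n_lists n [0..<n])"

text \<open>
  Transitivity in the form that no proper subset containing \<open>0\<close> is invariant. The candidate subsets
  are the sublists of \<open>[0..<n]\<close>.
\<close>

fun transitive_triple :: "nat \<Rightarrow> table_triple \<Rightarrow> bool" where
  "transitive_triple n (a, b, c) \<longleftrightarrow>
    (\<forall>A\<in>set (subseqs [0..<n]).
      0 \<in> set A \<and> (\<forall>i\<in>set A. a ! i \<in> set A \<and> b ! i \<in> set A \<and> c ! i \<in> set A)
      \<longrightarrow> set [0..<n] \<subseteq> set A)"

definition hecke_triples :: "nat \<Rightarrow> table_triple list" where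
  "hecke_triples n =
    filter (\<lambda>(a, b, c). (\<forall>i\<in>set [0..<n]. a ! (c ! i) = c ! (a ! i)) \<and> transitive_triple n (a, b, c))
      (List.product (involution_tables n)
        (List.product (involution_tables n) (involution_tables n)))"

text \<open>
  The table \<open>s\<close> of a permutation conjugates the first triple to the second. The equation is kept
  free of inverses so that it can be checked entry by entry.
\<close>

fun intertwines :: "nat \<Rightarrow> table_triple \<Rightarrow> table_triple \<Rightarrow> nat list \<Rightarrow> bool" where
  "intertwines n (a, b, c) (a', b', c') s \<longleftrightarrow>
    (\<forall>i\<in>set [0..<n]. s ! (a ! i) = a' ! (s ! i) \<and> s ! (b ! i) = b' ! (s ! i) \<and>
      s ! (c ! i) = c' ! (s ! i))"

definition related_by :: "nat \<Rightarrow> nat list list \<Rightarrow> table_triple \<Rightarrow> table_triple \<Rightarrow> bool" where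
  "related_by n S t u \<longleftrightarrow> (\<exists>s\<in>set S. intertwines n t u s)"

text \<open>
  For an equivalence relation \<open>R\<close> the first element of each class survives. Counting these
  elements gives the number of classes without forming sets of sets.
\<close>

fun representatives :: "('a \<Rightarrow> 'a \<Rightarrow> bool) \<Rightarrow> 'a list \<Rightarrow> 'a list" where
  "representatives R [] = []"
| "representatives R (x # xs) = x # representatives R (filter (\<lambda>y. \<not> R x y) xs)"

lemma length_representatives:
  assumes "\<And>x y. x \<in> set xs \<Longrightarrow> y \<in> set xs \<Longrightarrow> R x y \<longleftrightarrow> f x = f y"
  shows "length (representatives R xs) = card (f ` set xs)"
  using assms
proof (induction R xs rule: representatives.induct)
  case (2 R x xs)
  let ?ys = "filter (\<lambda>y. \<not> R x y) xs"
  have "length (representatives R ?ys) = card (f ` set ?ys)"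
    by (rule "2.IH") (simp add: "2.prems")
  moreover have "f ` set (x # xs) = insert (f x) (f ` set ?ys)" "f x \<notin> f ` set ?ys"
    using "2.prems" by auto
  ultimately show ?case by simp
qed simp

lemma all_gens: "(\<forall>x. P x) \<longleftrightarrow> P RefP \<and> P RefQ \<and> P RefR"
  by (metis hecke_gen.exhaust)

lemma set_involution_tables:
  "a \<in> set (involution_tables n) \<longleftrightarrow>
    length a = n \<and> (\<forall>i<n. a ! i < n \<and> a ! (a ! i) = i)"
proof -
  have "set a \<subseteq> {0..<n} \<longleftrightarrow> (\<forall>i<n. a ! i < n)" if "length a = n"
    using that by (auto simp: set_conv_nth)
  then show ?thesis by (auto simp: involution_tables_def set_n_lists)
qed

lemma transitive_triple_iff:
  "transitive_triple n t \<longleftrightarrow>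
    (\<forall>A\<subseteq>{..<n}. 0 \<in> A \<and> (\<forall>x. \<forall>i\<in>A. table_of t x ! i \<in> A) \<longrightarrow> A = {..<n})"
proof -
  obtain a b c where t: "t = (a, b, c)" by (cases t)
  have "transitive_triple n t \<longleftrightarrow> (\<forall>A\<in>set ` set (subseqs [0..<n]).
      0 \<in> A \<and> (\<forall>x. \<forall>i\<in>A. table_of t x ! i \<in> A) \<longrightarrow> {..<n} \<subseteq> A)"
    by (auto simp: t all_gens atLeast0LessThan)
  then show ?thesis by (auto simp: subseqs_powset atLeast0LessThan)
qed

lemma set_hecke_triples:
  "t \<in> set (hecke_triples n) \<longleftrightarrow> (\<forall>x. table_of t x \<in> set (involution_tables n)) \<and>
    (\<forall>i<n. table_of t RefP ! (table_of t RefR ! i) = table_of t RefR ! (table_of t RefP ! i)) \<and>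
    transitive_triple n t"
proof -
  obtain a b c where t: "t = (a, b, c)" by (cases t)
  show ?thesis unfolding t hecke_triples_def by (auto simp: all_gens)
qed

definition realizes :: "nat \<Rightarrow> nat \<Rightarrow> table_triple \<Rightarrow> (hecke_gen gword set \<Rightarrow> nat \<Rightarrow> nat) \<Rightarrow> bool" where
  "realizes p n t \<phi> \<longleftrightarrow> transitive_action (extended_hecke_group p) {..<n} \<phi> \<and>
    (\<forall>x. \<forall>i<n. \<phi> (hecke_elem p x) i = table_of t x ! i)"

lemma transitive_triple_realized:
  assumes "group_action (extended_hecke_group p) {..<n} \<phi>" and n: "0 < n"
    and tab: "\<And>x i. i < n \<Longrightarrow> \<phi> (hecke_elem p x) i = table_of t x ! i"
  shows "transitive_triple n t \<longleftrightarrow> transitive_action (extended_hecke_group p) {..<n} \<phi>"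
proof -
  interpret group_action "extended_hecke_group p" "{..<n}" \<phi> by fact
  have closed: "(\<forall>x. \<forall>i\<in>A. table_of t x ! i \<in> A) \<longleftrightarrow>
      (\<forall>s\<in>range (hecke_elem p). \<forall>i\<in>A. \<phi> s i \<in> A)" if "A \<subseteq> {..<n}" for A
  proof -
    have "\<phi> (hecke_elem p x) i = table_of t x ! i" if "i \<in> A" for x i
      using tab that \<open>A \<subseteq> {..<n}\<close> by blast
    then show ?thesis by simp
  qed
  have trans: "transitive_action (extended_hecke_group p) {..<n} \<phi> \<longleftrightarrow>
      (\<forall>A\<subseteq>{..<n}. 0 \<in> A \<and> (\<forall>s\<in>range (hecke_elem p). \<forall>i\<in>A. \<phi> s i \<in> A) \<longrightarrow> A = {..<n})"
    using n by (intro transitive_iff_no_invariant_subset generate_hecke_elem) simp_all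
  show ?thesis
    unfolding transitive_triple_iff trans by (intro all_cong1 imp_cong refl) (simp_all only: closed)
qed

lemma hecke_triple_realized:
  assumes t: "t \<in> set (hecke_triples n)" and n: "0 < n"
    and dvd: "\<And>k. 1 \<le> k \<Longrightarrow> k \<le> n \<Longrightarrow> k dvd p"
  shows "\<exists>\<phi>. realizes p n t \<phi>"
proof -
  have tab: "table_of t x ! i < n" "table_of t x ! (table_of t x ! i) = i" if "i < n" for x i
    using t that by (auto simp: set_hecke_triples set_involution_tables)
  have comm: "table_of t RefP ! (table_of t RefR ! i) = table_of t RefR ! (table_of t RefP ! i)"
    if "i < n" for i using t that by (auto simp: set_hecke_triples)
  obtain \<phi> where \<phi>: "group_action (extended_hecke_group p) {..<n} \<phi>"
      "\<And>x i. i \<in> {..<n} \<Longrightarrow> \<phi> (hecke_elem p x) i = table_of t x ! i"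
    using hecke_group_acts[of "{..<n}" p "\<lambda>x i. table_of t x ! i"] tab comm dvd by auto
  then show ?thesis
    using transitive_triple_realized[OF \<phi>(1) n, of t] t by (auto simp: realizes_def set_hecke_triples)
qed

lemma transitive_action_tabulated:
  assumes "transitive_action (extended_hecke_group p) {..<n} \<phi>" and n: "0 < n"
  shows "\<exists>t\<in>set (hecke_triples n). realizes p n t \<phi>"
proof -
  interpret transitive_action "extended_hecke_group p" "{..<n}" \<phi> by fact
  define tab where "tab x = map (\<phi> (hecke_elem p x)) [0..<n]" for x
  define t where "t = (tab RefP, tab RefQ, tab RefR)"
  have table: "table_of t x = tab x" for x by (cases x) (simp_all add: t_def)
  have tab: "tab x ! i = \<phi> (hecke_elem p x) i" if "i < n" for x i using that by (simp add: tab_def)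
  have stay: "\<phi> (hecke_elem p x) i < n" if "i < n" for x i
    using element_image[OF hecke_elem_carrier, of i] that by auto
  note rel = hecke_action_relations[OF group_action_axioms, simplified]
  have "tab x \<in> set (involution_tables n)" for x
    unfolding set_involution_tables by (simp add: tab stay rel) (simp add: tab_def)
  then have "t \<in> set (hecke_triples n)"
    unfolding set_hecke_triples
    using transitive_triple_realized[OF group_action_axioms n, of t] assms(1)
    by (simp add: table tab stay rel)
  moreover have "realizes p n t \<phi>" using assms(1) by (simp add: realizes_def table tab)
  ultimately show ?thesis by blast
qed

lemma intertwines_iff:
  "intertwines n t u s \<longleftrightarrow> (\<forall>x. \<forall>i<n. s ! (table_of t x ! i) = table_of u x ! (s ! i))"
  by (cases t; cases u) (auto simp: all_gens)

lemma set_permutation_tables: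
  "s \<in> set (permutation_tables n) \<longleftrightarrow> length s = n \<and> bij_betw (nth s) {..<n} {..<n}"
proof -
  have "distinct s \<and> set s \<subseteq> {..<n} \<longleftrightarrow> bij_betw (nth s) {..<n} {..<n}" if "length s = n"
  proof -
    have "bij_betw (nth s) {..<n} {..<n} \<longleftrightarrow> distinct s \<and> set s = {..<n}"
      using that by (auto simp: bij_betw_def distinct_conv_nth inj_on_def set_conv_nth)
    moreover have "set s = {..<n}" if "distinct s" "set s \<subseteq> {..<n}"
      using that \<open>length s = n\<close> by (intro card_subset_eq) (auto simp: distinct_card)
    ultimately show ?thesis by blast
  qed
  then show ?thesis by (auto simp: permutation_tables_def set_n_lists atLeast0LessThan)
qed

text \<open>
  The condition \<open>P\<close> on the image of \<open>0\<close> lets one statement serve both for isomorphisms that fix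
  the base point (equality of stabilizers) and for arbitrary ones (conjugacy of stabilizers).
\<close>

lemma action_iso_iff_intertwines:
  assumes t: "realizes p n t \<phi>" and u: "realizes p n u \<psi>" and n: "0 < n"
  shows "(\<exists>\<sigma>. action_iso (extended_hecke_group p) {..<n} \<phi> {..<n} \<psi> \<sigma> \<and> P (\<sigma> 0)) \<longleftrightarrow>
    (\<exists>s\<in>set (permutation_tables n). intertwines n t u s \<and> P (s ! 0))"
proof -
  interpret \<phi>: transitive_action "extended_hecke_group p" "{..<n}" \<phi> using t by (simp add: realizes_def)
  interpret \<psi>: transitive_action "extended_hecke_group p" "{..<n}" \<psi> using u by (simp add: realizes_def)
  have \<phi>: "\<phi> (hecke_elem p x) i = table_of t x ! i" and \<psi>: "\<psi> (hecke_elem p x) i = table_of u x ! i"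
    if "i < n" for x i using that t u by (simp_all add: realizes_def)
  have stay: "table_of t x ! i < n" if "i < n" for x i
    using \<phi>.element_image[OF hecke_elem_carrier, of i] that by (simp flip: \<phi>)
  show ?thesis
  proof
    assume "\<exists>\<sigma>. action_iso (extended_hecke_group p) {..<n} \<phi> {..<n} \<psi> \<sigma> \<and> P (\<sigma> 0)"
    then obtain \<sigma> where \<sigma>: "bij_betw \<sigma> {..<n} {..<n}" "P (\<sigma> 0)"
      "\<And>g i. g \<in> carrier (extended_hecke_group p) \<Longrightarrow> i < n \<Longrightarrow> \<sigma> (\<phi> g i) = \<psi> g (\<sigma> i)"
      by (auto simp: action_iso_def)
    define s where "s = map \<sigma> [0..<n]"
    have s: "s ! i = \<sigma> i" if "i < n" for i using that by (simp add: s_def)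
    have \<sigma>_less: "\<sigma> i < n" if "i < n" for i using \<sigma>(1) that by (auto simp: bij_betw_def)
    have "s ! (table_of t x ! i) = table_of u x ! (s ! i)" if "i < n" for x i
      using \<sigma>(3)[OF hecke_elem_carrier that, of x] that by (simp add: s stay \<sigma>_less \<phi> \<psi>)
    then have "intertwines n t u s" by (simp add: intertwines_iff)
    moreover have "s \<in> set (permutation_tables n)"
      using \<sigma>(1) bij_betw_cong[of "{..<n}" "nth s" \<sigma>] s by (simp add: set_permutation_tables) (simp add: s_def)
    ultimately show "\<exists>s\<in>set (permutation_tables n). intertwines n t u s \<and> P (s ! 0)"
      using \<sigma>(2) s[OF n] by auto
  next
    assume "\<exists>s\<in>set (permutation_tables n). intertwines n t u s \<and> P (s ! 0)"
    then obtain s where s: "bij_betw (nth s) {..<n} {..<n}" "P (s ! 0)"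
      "\<And>x i. i < n \<Longrightarrow> s ! (table_of t x ! i) = table_of u x ! (s ! i)"
      by (auto simp: set_permutation_tables intertwines_iff)
    have s_less: "s ! i < n" if "i < n" for i using s(1) that by (auto simp: bij_betw_def)
    have "action_iso (extended_hecke_group p) {..<n} \<phi> {..<n} \<psi> (nth s)"
      by (rule action_iso_generators[OF \<phi>.group_action_axioms \<psi>.group_action_axioms generate_hecke_elem s(1)])
        (auto simp: \<phi> \<psi> s(3) s_less)
    with s(2) show "\<exists>\<sigma>. action_iso (extended_hecke_group p) {..<n} \<phi> {..<n} \<psi> \<sigma> \<and> P (\<sigma> 0)" by blast
  qed
qed

section \<open>Counting\<close>

text \<open>
  Sending a triple \<open>t\<close> to the stabilizer \<open>K t\<close> of \<open>0\<close> in the action that realizes \<open>t\<close> reaches every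
  subgroup of index \<open>n\<close>. Two triples give the same subgroup exactly if a relabelling that fixes \<open>0\<close>
  relates them, and conjugate subgroups exactly if any relabelling does.
\<close>

lemma card_hecke_subgroups:
  assumes n: "0 < n" and dvd: "\<And>k. 1 \<le> k \<Longrightarrow> k \<le> n \<Longrightarrow> k dvd p"
  shows "card (subgroups_of_index (extended_hecke_group p) n) =
      length (representatives
        (related_by n (filter (\<lambda>s. s ! 0 = 0) (permutation_tables n))) (hecke_triples n))"
    and "card (subgroup_classes_of_index (extended_hecke_group p) n) =
      length (representatives (related_by n (permutation_tables n)) (hecke_triples n))"
proof -
  let ?H = "extended_hecke_group p"
  interpret group ?H by (rule group_extended_hecke_group)
  obtain \<phi> where \<phi>: "realizes p n t (\<phi> t)" if "t \<in> set (hecke_triples n)" for t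
    using hecke_triple_realized[OF _ n dvd] by metis
  define K where "K t = stabilizer ?H (\<phi> t) 0" for t
  let ?conj = "\<lambda>g. \<lambda>K\<in>{K. subgroup K ?H}. g <#\<^bsub>?H\<^esub> K #>\<^bsub>?H\<^esub> inv\<^bsub>?H\<^esub> g"
  have \<phi>_trans: "transitive_action ?H {..<n} (\<phi> t)" if "t \<in> set (hecke_triples n)" for t
    using \<phi>[OF that] by (simp add: realizes_def)
  have subgroups: "subgroups_of_index ?H n = K ` set (hecke_triples n)"
  proof
    show "K ` set (hecke_triples n) \<subseteq> subgroups_of_index ?H n"
    proof
      fix L assume "L \<in> K ` set (hecke_triples n)"
      then obtain t where t: "t \<in> set (hecke_triples n)" "L = K t" by blast
      interpret transitive_action ?H "{..<n}" "\<phi> t" by (rule \<phi>_trans[OF t(1)])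
      show "L \<in> subgroups_of_index ?H n"
        using card_rcosets_stabilizer[of 0] stabilizer_subgroup[of 0] n
        by (simp add: subgroups_of_index_def t(2) K_def)
    qed
    show "subgroups_of_index ?H n \<subseteq> K ` set (hecke_triples n)"
    proof
      fix L assume "L \<in> subgroups_of_index ?H n"
      then have L: "subgroup L ?H" "card (rcosets\<^bsub>?H\<^esub> L) = card {..<n}"
        by (simp_all add: subgroups_of_index_def)
      obtain \<psi> where \<psi>: "transitive_action ?H {..<n} \<psi>" "stabilizer ?H \<psi> 0 = L"
        using subgroup_is_stabilizer[OF L, of 0] n by auto
      obtain t where t: "t \<in> set (hecke_triples n)" "realizes p n t \<psi>"
        using transitive_action_tabulated[OF \<psi>(1) n] by blast
      \<comment> \<open>Both \<open>\<phi> t\<close> and \<open>\<psi>\<close> realize \<open>t\<close>, so the identity identifies them and fixes \<open>0\<close>.\<close>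
      have "intertwines n t t [0..<n]"
        using t(1) by (simp add: intertwines_iff set_hecke_triples set_involution_tables)
      moreover have "[0..<n] \<in> set (permutation_tables n)"
        by (auto simp: set_permutation_tables bij_betw_def inj_on_def image_iff)
      moreover have "[0..<n] ! 0 = 0" using n by simp
      ultimately have "stabilizer ?H (\<phi> t) 0 = stabilizer ?H \<psi> 0"
        using stabilizer_eq_iff_action_iso[OF \<phi>_trans[OF t(1)] \<psi>(1), of 0 0]
          action_iso_iff_intertwines[OF \<phi>[OF t(1)] t(2) n, of "\<lambda>i. i = 0"] n by auto
      then show "L \<in> K ` set (hecke_triples n)" using t(1) \<psi>(2) by (auto simp: K_def)
    qed
  qed
  show "card (subgroups_of_index ?H n) = length (representatives
      (related_by n (filter (\<lambda>s. s ! 0 = 0) (permutation_tables n))) (hecke_triples n))"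
    unfolding subgroups
  proof (rule length_representatives[symmetric])
    fix t u assume tu: "t \<in> set (hecke_triples n)" "u \<in> set (hecke_triples n)"
    show "related_by n (filter (\<lambda>s. s ! 0 = 0) (permutation_tables n)) t u \<longleftrightarrow> K t = K u"
      unfolding K_def related_by_def
      using stabilizer_eq_iff_action_iso[OF \<phi>_trans[OF tu(1)] \<phi>_trans[OF tu(2)], of 0 0]
        action_iso_iff_intertwines[OF \<phi>[OF tu(1)] \<phi>[OF tu(2)] n, of "\<lambda>i. i = 0"] n by auto
  qed
  have classes: "subgroup_classes_of_index ?H n =
      (\<lambda>t. orbit ?H ?conj (K t)) ` set (hecke_triples n)"
    unfolding subgroup_classes_of_index_def orbits_def subgroups by blast
  show "card (subgroup_classes_of_index ?H n) =
      length (representatives (related_by n (permutation_tables n)) (hecke_triples n))"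
    unfolding classes
  proof (rule length_representatives[symmetric])
    fix t u assume tu: "t \<in> set (hecke_triples n)" "u \<in> set (hecke_triples n)"
    show "related_by n (permutation_tables n) t u \<longleftrightarrow>
        orbit ?H ?conj (K t) = orbit ?H ?conj (K u)"
      unfolding K_def related_by_def
      using conjugate_stabilizers_iff_action_iso[OF \<phi>_trans[OF tu(1)] \<phi>_trans[OF tu(2)], of 0 0]
        action_iso_iff_intertwines[OF \<phi>[OF tu(1)] \<phi>[OF tu(2)] n, of "\<lambda>_. True"] n by auto
  qed
qed

text \<open>
  Rewriting with the defining equations enumerates the triples and sorts them into classes. The
  heaviest case compares the \<open>258\<close> triples on \<open>4\<close> points with \<open>22\<close> representatives under \<open>24\<close>
  relabellings.
\<close>

lemma pointed_classes_2:
  "length (representatives (related_by 2 (filter (\<lambda>s. s ! 0 = 0) (permutation_tables 2)))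
    (hecke_triples 2)) = 7"
  by code_simp

lemma classes_3:
  "length (representatives (related_by 3 (permutation_tables 3)) (hecke_triples 3)) = 3"
  by code_simp

lemma classes_4:
  "length (representatives (related_by 4 (permutation_tables 4)) (hecke_triples 4)) = 22"
  by code_simp

theorem theorem2:
  fixes p :: nat
  assumes "p \<ge> 3"
  shows "(2 dvd p \<longrightarrow> card (subgroups_of_index (extended_hecke_group p) 2) = 7)
    \<and> (2 dvd p \<and> 3 dvd p \<longrightarrow> card (subgroup_classes_of_index (extended_hecke_group p) 3) = 3)
    \<and> (2 dvd p \<and> 3 dvd p \<and> 4 dvd p \<longrightarrow>
         card (subgroup_classes_of_index (extended_hecke_group p) 4) = 22)"
proof (intro conjI impI)
  assume p: "2 dvd p"
  have "k dvd p" if "1 \<le> k" "k \<le> 2" for k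
  proof -
    have "k = 1 \<or> k = 2" using that by linarith
    with p show ?thesis by auto
  qed
  then show "card (subgroups_of_index (extended_hecke_group p) 2) = 7"
    using card_hecke_subgroups(1)[of 2 p] pointed_classes_2 by simp
next
  assume p: "2 dvd p \<and> 3 dvd p"
  have "k dvd p" if "1 \<le> k" "k \<le> 3" for k
  proof -
    have "k = 1 \<or> k = 2 \<or> k = 3" using that by linarith
    with p show ?thesis by auto
  qed
  then show "card (subgroup_classes_of_index (extended_hecke_group p) 3) = 3"
    using card_hecke_subgroups(2)[of 3 p] classes_3 by simp
next
  assume p: "2 dvd p \<and> 3 dvd p \<and> 4 dvd p"
  have "k dvd p" if "1 \<le> k" "k \<le> 4" for k
  proof -
    have "k = 1 \<or> k = 2 \<or> k = 3 \<or> k = 4" using that by linarith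
    with p show ?thesis by auto
  qed
  then show "card (subgroup_classes_of_index (extended_hecke_group p) 4) = 22"
    using card_hecke_subgroups(2)[of 4 p] classes_4 by simp
qed

end
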